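(* Let $p>1$ be a real number and let $0<a<\pi_p/2$. Then for all $x\in(0,a)$, $$e^{\alpha_1 x^p}<\cos_p x<e^{\beta_1 x^p}$$ with the best possible constants $\alpha_1=\dfrac{\ln(\cos_p a)}{a^p}$ and $\beta_1=-\dfrac1p$. Here "best possible" means that $\alpha_1$ cannot be replaced by any larger constant, and $\beta_1$ cannot be replaced by any smaller constant, so that the respective inequality still holds for all $x\in(0,a)$.
   Context: For real $1<p<\infty$, define $\arcsin_p:[0,1]\to\mathbb{R}$ by $\arcsin_p(x)=\int_0^x\frac{dt}{(1-t^p)^{1/p}}$, and let $\pi_p=2\arcsin_p(1)=\frac{2\pi}{p\sin(\pi/p)}$. The generalized sine function $\sin_p:[0,\pi_p/2]\to[0,1]$ is the inverse of $\arcsin_p$. The generalized cosine function is $\cos_p x=\frac{d}{dx}\sin_p x$ for $x\in[0,\pi_p/2]$ (equivalently $\cos_p x=(1-\sin_p^p x)^{1/p}$, where $\sin_p^p x=(\sin_p x)^p$). *)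

theory Defs
  imports "HOL-Analysis.Analysis"
begin

text \<open>
  For \<open>x = 1\<close> the integral below is improper at its upper limit. The Henstock--Kurzweil
  integral covers this case; the integrand takes the irrelevant value \<open>1 / 0 = 0\<close> at \<open>t = 1\<close>.
\<close>

definition arcsin_p :: "real \<Rightarrow> real \<Rightarrow> real" where
  "arcsin_p p x = integral {0..x} (\<lambda>t. 1 / (1 - t powr p) powr (1 / p))"

definition pi_p :: "real \<Rightarrow> real" where
  "pi_p p = 2 * arcsin_p p 1"

text \<open>Meaningful for \<open>x \<in> {0..pi_p p / 2}\<close> only, and likewise for \<open>cos_p\<close>.\<close>

definition sin_p :: "real \<Rightarrow> real \<Rightarrow> real" where
  "sin_p p = inv_into {0..1} (arcsin_p p)"

text \<open>
  The derivative is relative to the interval on which \<open>sin_p\<close> is defined, so it is one-sided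
  at the two end points.
\<close>

definition cos_p :: "real \<Rightarrow> real \<Rightarrow> real" where
  "cos_p p x = vector_derivative (sin_p p) (at x within {0..pi_p p / 2})"

end

theory Submission
  imports Defs
begin

text \<open>
  Put \<open>s = sin_p p x\<close>, so that \<open>x = arcsin_p p s\<close> and \<open>cos_p p x = (1 - s powr p) powr (1 / p)\<close>.
  Taking logarithms, an inequality between \<open>cos_p p x\<close> and \<open>exp (\<gamma> * x powr p)\<close> is one between
  \<open>\<gamma> * p\<close> and the quotient
  \[ G(s) = \frac{\ln (1 - s^p)}{(\arcsin_p s)^p}. \]
  Everything therefore follows from two facts: \<open>G\<close> is continuous and strictly decreasing on \<open>(0, 1)\<close>
  (\<open>quotient_deriv\<close>, \<open>quotient_strict_antimono\<close>), and \<open>G\<close> tends to \<open>- 1\<close> at \<open>0\<close>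
  (\<open>quotient_tendsto\<close>). On \<open>(0, a)\<close> the quotient lies strictly between its value at \<open>sin_p p a\<close>
  and \<open>- 1\<close>, and it comes arbitrarily close to both, which makes both constants best possible.

  The limit comes from \<open>ln (1 - u) \<sim> - u\<close> and \<open>arcsin_p p s \<sim> s\<close>. For the monotonicity, write
  \<open>tan\<close> for the quotient of the generalized sine and cosine. Differentiating with respect to \<open>x\<close> turns
  \<open>G' < 0\<close> into \<open>x * tan x powr (p - 1) + p * ln (cos x) > 0\<close> (\<open>ln_cos_lower_bound\<close>). The left side
  vanishes at \<open>0\<close>, and its derivative is positive as soon as \<open>tan x < x * tan' x\<close>
  (\<open>arcsin_p_lower_bound\<close>). This last inequality holds because \<open>tan\<close>
  is strictly convex and vanishes at \<open>0\<close>.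
  The lemmas state these inequalities in the variable \<open>s\<close>, in which all derivatives are explicit.
  Only at the end does the inverse function theorem (\<open>cos_p_arcsin_p\<close>) bring in the cosine.
\<close>

section \<open>The generalized arcsine\<close>

text \<open>
  The singularity at \<open>1\<close> is no worse than that of \<open>(1 - t) powr (- (1 / p))\<close>, since
  \<open>t powr p \<le> t\<close>; that power is integrable because its exponent exceeds \<open>- 1\<close>.
\<close>

lemma arcsin_p_integrand_integrable:
  assumes "p > (1::real)"
  shows "(\<lambda>t. 1 / (1 - t powr p) powr (1 / p)) integrable_on {0..1}"
proof (rule measurable_bounded_by_integrable_imp_integrable_real)
  have *: "(\<lambda>t. t powr (- (1/p))) integrable_on {0..1::real}"
    using integrable_on_powr_from_0[of "- (1/p)" 1] assms by (simp add: field_simps)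
  have "(\<lambda>t. (- t) powr (- (1/p))) integrable_on {-1..0::real}"
    using Henstock_Kurzweil_Integration.integrable_reflect_real[of "\<lambda>t. t powr (- (1/p))" 1 0] * by simp
  then have "((\<lambda>t. (- t) powr (- (1/p))) \<circ> (+) (- 1)) integrable_on {0..1::real}"
    by (subst integrable_on_shift_Icc_real) simp
  then show "(\<lambda>t. (1 - t) powr (- (1/p))) integrable_on {0..1::real}"
    by (simp add: o_def)
  show "\<bar>1 / (1 - t powr p) powr (1 / p)\<bar> \<le> (1 - t) powr (- (1/p))" if "t \<in> {0..1}" for t
  proof (cases "t = 1")
    case False
    then have "t < 1" "t powr p \<le> t powr 1"
      using that assms powr_mono'[of 1 p t] by auto
    then have "(1 - t) powr (1/p) \<le> (1 - t powr p) powr (1/p)"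
      using that assms by (intro powr_mono2) auto
    moreover have "0 < (1 - t) powr (1/p)" using \<open>t < 1\<close> by simp
    ultimately show ?thesis
      by (simp add: powr_minus_divide frac_le)
  qed simp
  have "(\<lambda>t. 1 / (1 - t powr p) powr (1 / p)) \<in> borel_measurable lborel"
    by measurable
  then show "(\<lambda>t. 1 / (1 - t powr p) powr (1 / p)) \<in> borel_measurable (lebesgue_on {0..1})"
    by (intro measurable_restrict_space1 measurable_completion)
qed simp

lemma arcsin_p_0 [simp]: "arcsin_p p 0 = 0"
  by (simp add: arcsin_p_def)

lemma continuous_on_arcsin_p:
  assumes "p > 1"
  shows "continuous_on {0..1} (arcsin_p p)"
  unfolding arcsin_p_def
  by (rule indefinite_integral_continuous_1[OF arcsin_p_integrand_integrable[OF assms]])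

lemma powr_less_one_of_less_one: "0 \<le> s \<Longrightarrow> s < 1 \<Longrightarrow> p > 0 \<Longrightarrow> s powr p < (1::real)"
  using powr_less_mono2[of p s 1] by simp

text \<open>
  The one-sided derivative at \<open>0\<close> gives \<open>arcsin_p p s \<sim> s\<close>, on which the limit of the
  quotient at \<open>0\<close> depends.
\<close>

lemma arcsin_p_deriv_within:
  assumes "p > 1" "0 \<le> s" "s < 1"
  shows "(arcsin_p p has_real_derivative (1 - s powr p) powr (- (1 / p))) (at s within {0..1})"
proof -
  have "continuous (at s within {0..1}) (\<lambda>t. 1 / (1 - t powr p) powr (1 / p))"
    unfolding continuous_within using assms powr_less_one_of_less_one[of s p]
    by (intro tendsto_intros tendsto_powr') (auto simp: eventually_at_filter)
  then have "((\<lambda>u. integral {0..u} (\<lambda>t. 1 / (1 - t powr p) powr (1 / p)))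
      has_vector_derivative 1 / (1 - s powr p) powr (1 / p)) (at s within {0..1})"
    using integral_has_vector_derivative_continuous_at[OF arcsin_p_integrand_integrable, of p s "{}"]
      assms by simp
  then show ?thesis
    by (simp add: arcsin_p_def[abs_def] has_real_derivative_iff_has_vector_derivative powr_minus_divide)
qed

lemma arcsin_p_deriv:
  assumes "p > 1" "0 < s" "s < 1"
  shows "(arcsin_p p has_real_derivative (1 - s powr p) powr (- (1 / p))) (at s)"
proof -
  have "at s within {0..1} = at s" using assms by (intro at_within_interior) auto
  then show ?thesis using arcsin_p_deriv_within[of p s] assms by simp
qed

lemma arcsin_p_strict_mono:
  assumes "p > 1" "0 \<le> s" "s < t" "t \<le> 1"
  shows "arcsin_p p s < arcsin_p p t"
proof (rule DERIV_pos_imp_increasing_open[OF \<open>s < t\<close>])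
  show "\<exists>y. (arcsin_p p has_real_derivative y) (at x) \<and> 0 < y" if "s < x" "x < t" for x
    using arcsin_p_deriv[of p x] powr_less_one_of_less_one[of x p] that assms
    by (intro exI[of _ "(1 - x powr p) powr (- (1 / p))"]) auto
  show "continuous_on {s..t} (arcsin_p p)"
    using continuous_on_arcsin_p[OF assms(1)] by (rule continuous_on_subset) (use assms in auto)
qed

lemma arcsin_p_pos: "p > 1 \<Longrightarrow> 0 < s \<Longrightarrow> s \<le> 1 \<Longrightarrow> 0 < arcsin_p p s"
  using arcsin_p_strict_mono[of p 0 s] by simp

section \<open>The quotient of logarithmic cosine and power\<close>

text \<open>
  With \<open>x = arcsin_p p s\<close> this says \<open>tan x < x * tan' x\<close>: here \<open>tan x = s * D powr (- (1 / p))\<close>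
  and \<open>tan' x = 1 / D\<close> for \<open>D = 1 - s powr p\<close>. In the variable \<open>s\<close>, the difference of the two
  sides vanishes at \<open>0\<close> and has derivative \<open>p * s powr p * D powr (- (1 / p)) > 0\<close>.
\<close>

lemma arcsin_p_lower_bound:
  assumes p: "p > 1" and s: "0 < s" "s < 1"
  shows "s * (1 - s powr p) powr (1 - 1 / p) < arcsin_p p s"
proof -
  let ?K = "\<lambda>s. arcsin_p p s - s * (1 - s powr p) powr (1 - 1 / p)"
  have "?K 0 < ?K s"
  proof (rule DERIV_pos_imp_increasing_open[OF s(1)])
    fix x assume x: "0 < x" "x < s"
    define D where "D = 1 - x powr p"
    have D: "D > 0" using powr_less_one_of_less_one[of x p] x s p by (simp add: D_def)
    have "(?K has_real_derivative D powr (- (1/p)) -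
       (D powr (1 - 1/p) + x * ((1 - 1/p) * D powr (- (1/p)) * (- (p * x powr (p - 1)))))) (at x)"
      using arcsin_p_deriv[of p x] x s p D unfolding D_def
      by (auto intro!: derivative_eq_intros simp: powr_diff field_simps)
    moreover have "D powr (- (1/p)) -
       (D powr (1 - 1/p) + x * ((1 - 1/p) * D powr (- (1/p)) * (- (p * x powr (p - 1)))))
       = D powr (- (1/p)) * (p * x powr p)"
    proof -
      have "D powr (1 - 1/p) = D powr (- (1/p)) * (1 - x powr p)"
        using D powr_add[of D "- (1/p)" 1] by (simp add: D_def)
      moreover have "x powr p = x * x powr (p - 1)"
        using x powr_add[of x 1 "p - 1"] by simp
      ultimately show ?thesis using p by (simp only:) (simp add: field_simps)
    qed
    ultimately show "\<exists>y. (?K has_real_derivative y) (at x) \<and> 0 < y"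
      using D x p by (intro exI[of _ "D powr (- (1/p)) * (p * x powr p)"]) auto
  next
    show "continuous_on {0..s} ?K"
      using s p powr_less_one_of_less_one[of _ p]
      by (intro continuous_intros continuous_on_subset[OF continuous_on_arcsin_p[OF p]]
          continuous_on_powr') (force simp: powr_le1)+
  qed
  then show ?thesis by simp
qed

text \<open>
  This is the inequality \<open>x * tan x powr (p - 1) + p * ln (cos x) > 0\<close> in the variable \<open>s\<close>. The
  expression vanishes at \<open>0\<close>, and its derivative is a positive multiple of the difference of the
  two sides in \<open>arcsin_p_lower_bound\<close>.
\<close>

lemma ln_cos_lower_bound:
  assumes p: "p > 1" and s: "0 < s" "s < 1"
  shows "0 < arcsin_p p s * s powr (p - 1) * (1 - s powr p) powr (1 / p - 1) + ln (1 - s powr p)"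
proof -
  let ?H = "\<lambda>s. arcsin_p p s * s powr (p - 1) * (1 - s powr p) powr (1 / p - 1) + ln (1 - s powr p)"
  have "?H 0 < ?H s"
  proof (rule DERIV_pos_imp_increasing_open[OF s(1)])
    fix x assume x: "0 < x" "x < s"
    define D where "D = 1 - x powr p"
    define A where "A = arcsin_p p x"
    define E where "E = D powr (1/p - 2)"
    have D: "D > 0" using powr_less_one_of_less_one[of x p] x s p by (simp add: D_def)
    let ?y = "D powr (- (1/p)) * x powr (p - 1) * D powr (1/p - 1)
       + A * ((p - 1) * x powr (p - 2)) * D powr (1/p - 1)
       + A * x powr (p - 1) * ((1/p - 1) * E * (- (p * x powr (p - 1))))
       - p * x powr (p - 1) / D"
    have "(?H has_real_derivative ?y) (at x)"
      using arcsin_p_deriv[of p x] x s p D unfolding D_def A_def E_def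
      by (auto intro!: derivative_eq_intros simp: algebra_simps)
    moreover have "?y = (p - 1) * x powr (p - 2) * E * (A - x * D powr (1 - 1/p))"
    proof -
      \<comment> \<open>Every power is written through \<open>x powr (p - 2)\<close>, \<open>E\<close> and \<open>D\<close>;
        then \<open>D + x powr p = 1\<close> collapses the terms with factor \<open>A\<close>.\<close>
      have 1: "D powr (1/p - 1) = E * D"
        using D powr_add[of D "1/p - 2" 1] by (simp add: E_def)
      have 2: "x powr (p - 1) = x * x powr (p - 2)"
        using x powr_add[of x 1 "p - 2"] by simp
      have 3: "D powr (- (1/p)) * D powr (1/p - 1) = 1 / D"
        using D by (simp add: powr_neg_one flip: powr_add)
      have 4: "E * D powr (1 - 1/p) = 1 / D"
        using D by (simp add: E_def powr_neg_one flip: powr_add)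
      have 5: "D = 1 - x * x * x powr (p - 2)"
        using x powr_add[of x 2 "p - 2"] by (simp add: D_def power2_eq_square)
      have "?y = (D powr (- (1/p)) * D powr (1/p - 1)) * (x * x powr (p - 2))
         + (p - 1) * A * x powr (p - 2) * E * (D + x * x * x powr (p - 2))
         - p * x * x powr (p - 2) / D"
        unfolding 2 using p by (simp add: 1) (simp add: field_simps)
      also have "\<dots> = (p - 1) * A * x powr (p - 2) * E
         - (p - 1) * (x * x powr (p - 2)) * (1 / D)"
        unfolding 3 by (subst 5) (use D in \<open>simp add: field_simps\<close>)
      also have "\<dots> = (p - 1) * x powr (p - 2) * E * (A - x * D powr (1 - 1/p))"
        unfolding 4[symmetric] by (simp add: algebra_simps)
      finally show ?thesis .
    qed
    moreover have "0 < (p - 1) * x powr (p - 2) * E * (A - x * D powr (1 - 1/p))"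
      using arcsin_p_lower_bound[of p x] x s p D by (simp add: A_def D_def E_def)
    ultimately show "\<exists>y. (?H has_real_derivative y) (at x) \<and> 0 < y" by auto
  next
    have "x powr p < 1" if "x \<in> {0..s}" for x
      using that s p powr_less_one_of_less_one[of x p] by auto
    then show "continuous_on {0..s} ?H"
      using s p
      by (intro continuous_intros continuous_on_subset[OF continuous_on_arcsin_p[OF p]]
          continuous_on_powr') force+
  qed
  then show ?thesis by simp
qed

text \<open>
  By the quotient rule, the derivative is a negative multiple of the expression shown to be
  positive in \<open>ln_cos_lower_bound\<close>.
\<close>

lemma quotient_deriv:
  assumes p: "p > 1" and x: "0 < x" "x < 1"
  shows "\<exists>y<0. ((\<lambda>s. ln (1 - s powr p) / arcsin_p p s powr p) has_real_derivative y) (at x)"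
proof -
  define D where "D = 1 - x powr p"
  define A where "A = arcsin_p p x"
  have D: "D > 0" using powr_less_one_of_less_one[of x p] x p by (simp add: D_def)
  have A: "A > 0" using arcsin_p_pos[of p x] x p by (simp add: A_def)
  let ?y = "(- (p * x powr (p - 1)) / D * A powr p - ln D * (p * A powr (p - 1) * D powr (- (1/p))))
            / (A powr p * A powr p)"
  have "((\<lambda>s. ln (1 - s powr p) / arcsin_p p s powr p) has_real_derivative ?y) (at x)"
    using arcsin_p_deriv[of p x] x p D A unfolding D_def A_def
    by (auto intro!: derivative_eq_intros)
  moreover have "?y < 0"
  proof -
    have 1: "A powr p = A * A powr (p - 1)" using A powr_add[of A 1 "p - 1"] by simp
    have 2: "D powr (- (1/p)) * D powr (1/p - 1) = 1 / D"
      using D by (simp add: powr_neg_one flip: powr_add)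
    \<comment> \<open>Splitting \<open>1 / D\<close> by fact 2 exposes the factor \<open>D powr (- (1/p))\<close> shared with the other term.\<close>
    have "- (p * x powr (p - 1)) / D * A powr p - ln D * (p * A powr (p - 1) * D powr (- (1/p)))
       = - (p * x powr (p - 1)) * (1 / D) * A powr p - ln D * (p * A powr (p - 1) * D powr (- (1/p)))"
      by simp
    also have "\<dots> = - (p * A powr (p - 1) * D powr (- (1/p)) * (A * x powr (p - 1) * D powr (1/p - 1) + ln D))"
      unfolding 2[symmetric] 1 by (simp add: algebra_simps)
    also have "\<dots> < 0"
      using ln_cos_lower_bound[OF p x] A D p by (simp add: A_def D_def)
    finally show ?thesis using A by (intro divide_neg_pos) auto
  qed
  ultimately show ?thesis by blast
qed

lemma quotient_strict_antimono:
  assumes p: "p > 1" and "0 < s" "s < t" "t < 1"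
  shows "ln (1 - t powr p) / arcsin_p p t powr p < ln (1 - s powr p) / arcsin_p p s powr p"
proof (rule DERIV_neg_imp_decreasing[OF \<open>s < t\<close>])
  fix x assume "s \<le> x" "x \<le> t"
  then show "\<exists>y. ((\<lambda>s. ln (1 - s powr p) / arcsin_p p s powr p) has_real_derivative y) (at x) \<and> y < 0"
    using quotient_deriv[OF p, of x] assms by auto
qed

text \<open>
  The quotient is \<open>(ln (1 - u) / u) / (arcsin_p p s / s) powr p\<close> with \<open>u = s powr p\<close>; both
  fractions are difference quotients at \<open>0\<close>.
\<close>

lemma quotient_tendsto:
  assumes p: "p > 1"
  shows "((\<lambda>s. ln (1 - s powr p) / arcsin_p p s powr p) \<longlongrightarrow> - 1) (at_right 0)"
proof -
  have "at_right 0 = at 0 within {0..1::real}"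
    by (subst at_within_Icc_at_right) auto
  then have "((\<lambda>s. arcsin_p p s / s) \<longlongrightarrow> 1) (at_right 0)"
    using arcsin_p_deriv_within[OF p, of 0] by (simp add: has_field_derivative_iff)
  then have 1: "((\<lambda>s. (arcsin_p p s / s) powr p) \<longlongrightarrow> 1 powr p) (at_right 0)"
    by (intro tendsto_intros) auto
  have "((\<lambda>u. ln (1 - u)) has_real_derivative - 1) (at 0)"
    by (auto intro!: derivative_eq_intros)
  then have "((\<lambda>u. ln (1 - u) / u) \<longlongrightarrow> - 1) (at (0::real))"
    by (simp add: has_field_derivative_iff)
  moreover have "filterlim (\<lambda>s. s powr p) (at 0) (at_right (0::real))"
    unfolding filterlim_at using p
    by (auto intro!: tendsto_eq_intros tendsto_powr' simp: eventually_at_filter)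
  ultimately have "((\<lambda>s. ln (1 - s powr p) / s powr p) \<longlongrightarrow> - 1) (at_right 0)"
    by (rule filterlim_compose)
  from tendsto_divide[OF this 1]
  have "((\<lambda>s. ln (1 - s powr p) / s powr p / (arcsin_p p s / s) powr p) \<longlongrightarrow> - 1) (at_right 0)"
    by simp
  moreover have "\<forall>\<^sub>F s in at_right 0. ln (1 - s powr p) / s powr p / (arcsin_p p s / s) powr p
        = ln (1 - s powr p) / arcsin_p p s powr p"
    using eventually_at_right_real[OF zero_less_one]
    by eventually_elim (use arcsin_p_pos[OF p] in \<open>auto simp: powr_divide\<close>)
  ultimately show ?thesis by (rule Lim_transform_eventually)
qed

section \<open>The generalized sine and cosine\<close>

lemma arcsin_p_inj_on: "p > 1 \<Longrightarrow> inj_on (arcsin_p p) {0..1}"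
  by (rule linorder_inj_onI) (use arcsin_p_strict_mono in force)+

lemma sin_p_arcsin_p: "p > 1 \<Longrightarrow> s \<in> {0..1} \<Longrightarrow> sin_p p (arcsin_p p s) = s"
  unfolding sin_p_def by (rule inv_into_f_f[OF arcsin_p_inj_on])

lemma arcsin_p_image:
  assumes "p > 1"
  shows "arcsin_p p ` {0..1} = {0..pi_p p / 2}"
proof -
  have "arcsin_p p x \<in> {0..arcsin_p p 1}" if "x \<in> {0..1}" for x
    using that arcsin_p_strict_mono[OF assms, of 0 x] arcsin_p_strict_mono[OF assms, of x 1]
    by (cases "x = 0"; cases "x = 1"; force)
  moreover have "y \<in> arcsin_p p ` {0..1}" if "y \<in> {0..arcsin_p p 1}" for y
    using IVT'[of "arcsin_p p" 0 y 1] continuous_on_arcsin_p[OF assms] that by auto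
  ultimately show ?thesis by (auto simp: pi_p_def)
qed

text \<open>
  On the open interval the relative derivative in \<open>cos_p\<close> is an ordinary one, and the inverse
  function theorem gives it as the reciprocal of the integrand of \<open>arcsin_p\<close>.
\<close>

lemma cos_p_arcsin_p:
  assumes p: "p > 1" and s: "0 < s" "s < 1"
  shows "cos_p p (arcsin_p p s) = (1 - s powr p) powr (1 / p)"
proof -
  let ?I = "{0..pi_p p / 2}"
  have int: "arcsin_p p s \<in> interior ?I"
    using arcsin_p_strict_mono[OF p, of 0 s] arcsin_p_strict_mono[OF p, of s 1] s
    by (simp add: pi_p_def)
  have D: "1 - s powr p > 0" using powr_less_one_of_less_one[of s p] s p by simp
  have "continuous_on ?I (sin_p p)"
    using continuous_on_inv[OF continuous_on_arcsin_p[OF p]] sin_p_arcsin_p[OF p]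
    by (simp add: arcsin_p_image[OF p])
  then have cont: "isCont (sin_p p) (arcsin_p p s)"
    using int by (rule continuous_on_interior)
  have "(sin_p p has_real_derivative inverse ((1 - s powr p) powr (- (1 / p)))) (at (arcsin_p p s))"
  proof (rule DERIV_inverse_function[where f = "arcsin_p p" and a = 0 and b = "pi_p p / 2"])
    show "(arcsin_p p has_real_derivative (1 - s powr p) powr (- (1 / p))) (at (sin_p p (arcsin_p p s)))"
      using arcsin_p_deriv[OF p s] sin_p_arcsin_p[OF p, of s] s by simp
    show "arcsin_p p (sin_p p y) = y" if "0 < y" "y < pi_p p / 2" for y
      unfolding sin_p_def using that arcsin_p_image[OF p] by (intro f_inv_into_f) auto
  qed (use D int cont in auto)
  then have "(sin_p p has_vector_derivative (1 - s powr p) powr (1 / p)) (at (arcsin_p p s))"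
    using D by (simp add: has_real_derivative_iff_has_vector_derivative powr_minus)
  then show ?thesis
    unfolding cos_p_def at_within_interior[OF int] by (rule vector_derivative_at)
qed

text \<open>
  In this form, comparing \<open>cos_p\<close> with \<open>exp (\<gamma> * x powr p)\<close> amounts to comparing exponents.
\<close>

lemma cos_p_arcsin_p_eq_exp:
  assumes p: "p > 1" and s: "0 < s" "s < 1"
  shows "cos_p p (arcsin_p p s) =
    exp (ln (1 - s powr p) / arcsin_p p s powr p / p * arcsin_p p s powr p)"
  using cos_p_arcsin_p[OF assms] arcsin_p_pos[OF p, of s] powr_less_one_of_less_one[of s p] assms
  by (simp add: powr_def)

theorem theorem3p2:
  fixes p a :: real
  assumes "p > 1" and "0 < a" and "a < pi_p p / 2"
  shows "(\<forall>x\<in>{0<..<a}.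
            exp (ln (cos_p p a) / a powr p * x powr p) < cos_p p x \<and>
            cos_p p x < exp (- (1 / p) * x powr p)) \<and>
         (\<forall>\<alpha> > ln (cos_p p a) / a powr p.
            \<not> (\<forall>x\<in>{0<..<a}. exp (\<alpha> * x powr p) < cos_p p x)) \<and>
         (\<forall>\<beta> < - (1 / p).
            \<not> (\<forall>x\<in>{0<..<a}. cos_p p x < exp (\<beta> * x powr p)))"
proof -
  note p = \<open>p > 1\<close>
  let ?G = "\<lambda>s. ln (1 - s powr p) / arcsin_p p s powr p"
  have preimage: "\<exists>s. 0 < s \<and> s < 1 \<and> x = arcsin_p p s" if "0 < x" "x < pi_p p / 2" for x
  proof -
    have "x \<in> arcsin_p p ` {0..1}"
      unfolding arcsin_p_image[OF p] using that by simp
    then obtain s where s: "s \<in> {0..1}" "x = arcsin_p p s" by blast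
    with that have "s \<noteq> 0" "s \<noteq> 1" by (auto simp: pi_p_def)
    with s show ?thesis by (intro exI[of _ s]) auto
  qed
  obtain b where b: "0 < b" "b < 1" "a = arcsin_p p b" using preimage assms by blast
  have quotient_at_b: "ln (cos_p p a) / a powr p * p = ?G b"
    using cos_p_arcsin_p_eq_exp[OF p b(1,2)] arcsin_p_pos[OF p b(1)] b p by simp
  have in_range: "arcsin_p p s \<in> {0<..<a}" if "0 < s" "s < b" for s
    using that b arcsin_p_pos[OF p] arcsin_p_strict_mono[OF p, of s b] by auto
  \<comment> \<open>In terms of \<open>s\<close>, each inequality compares \<open>p\<close> times its constant with the quotient.\<close>
  have compare: "exp (\<gamma> * arcsin_p p s powr p) < cos_p p (arcsin_p p s) \<longleftrightarrow> \<gamma> * p < ?G s"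
       "cos_p p (arcsin_p p s) < exp (\<gamma> * arcsin_p p s powr p) \<longleftrightarrow> ?G s < \<gamma> * p"
    if "0 < s" "s < b" for s \<gamma>
  proof -
    have s: "0 < s" "s < 1" using that b by auto
    have pos: "0 < arcsin_p p s powr p" "0 < p" using arcsin_p_pos[OF p, of s] s p by auto
    show "exp (\<gamma> * arcsin_p p s powr p) < cos_p p (arcsin_p p s) \<longleftrightarrow> \<gamma> * p < ?G s"
       "cos_p p (arcsin_p p s) < exp (\<gamma> * arcsin_p p s powr p) \<longleftrightarrow> ?G s < \<gamma> * p"
      unfolding cos_p_arcsin_p_eq_exp[OF p s] exp_less_cancel_iff
        mult_less_cancel_right_pos[OF pos(1)]
        pos_less_divide_eq[OF pos(2)] pos_divide_less_eq[OF pos(2)]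
      by (rule refl)+
  qed
  have below: "?G s < - 1" if "0 < s" "s < b" for s
  proof -
    \<comment> \<open>Monotonicity alone bounds the values by the limit weakly; an intermediate point makes it strict.\<close>
    have "?G (s / 2) \<le> - 1"
    proof (rule tendsto_lowerbound[OF quotient_tendsto[OF p]])
      show "\<forall>\<^sub>F t in at_right 0. ?G (s / 2) \<le> ?G t"
        using eventually_at_right_real[of 0 "s / 2"] that b
        by (auto elim!: eventually_mono intro!: less_imp_le quotient_strict_antimono[OF p])
    qed simp
    then show ?thesis using quotient_strict_antimono[OF p, of "s / 2" s] that b by linarith
  qed
  have bounds: "exp (ln (cos_p p a) / a powr p * x powr p) < cos_p p x \<and>
            cos_p p x < exp (- (1 / p) * x powr p)" if x: "x \<in> {0<..<a}" for x
  proof -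
    obtain s where s: "0 < s" "s < 1" "x = arcsin_p p s"
      using preimage[of x] x assms by auto
    have "s < b"
      using arcsin_p_strict_mono[OF p, of b s] s b x by (cases s b rule: linorder_cases) auto
    have "- (1 / p) * p = - 1" using p by simp
    then show ?thesis
      unfolding s(3) compare[OF s(1) \<open>s < b\<close>] quotient_at_b
      using quotient_strict_antimono[OF p s(1) \<open>s < b\<close> b(2)] below[OF s(1) \<open>s < b\<close>] by simp
  qed
  have alpha: "\<exists>x\<in>{0<..<a}. \<not> exp (\<alpha> * x powr p) < cos_p p x"
    if \<alpha>: "\<alpha> > ln (cos_p p a) / a powr p" for \<alpha>
  proof -
    have "isCont ?G b" using quotient_deriv[OF p b(1,2)] DERIV_isCont by blast
    then have "(?G \<longlongrightarrow> ?G b) (at_left b)"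
      unfolding isCont_def by (rule tendsto_within_subset) simp
    moreover have "?G b < \<alpha> * p"
      using mult_strict_right_mono[OF \<alpha>, of p] p unfolding quotient_at_b by simp
    ultimately have "\<forall>\<^sub>F s in at_left b. ?G s < \<alpha> * p" by (rule order_tendstoD)
    then have "\<forall>\<^sub>F s in at_left b. ?G s < \<alpha> * p \<and> s \<in> {0<..<b}"
      using eventually_at_left_real[OF b(1)] by (rule eventually_conj)
    then obtain s where s: "?G s < \<alpha> * p" "0 < s" "s < b"
      using eventually_happens'[OF trivial_limit_at_left_real] by fastforce
    then have "\<not> exp (\<alpha> * arcsin_p p s powr p) < cos_p p (arcsin_p p s)"
      unfolding compare[OF s(2,3)] by simp
    then show ?thesis using in_range[OF s(2,3)] by blast
  qed
  have beta: "\<exists>x\<in>{0<..<a}. \<not> cos_p p x < exp (\<beta> * x powr p)"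
    if \<beta>: "\<beta> < - (1 / p)" for \<beta>
  proof -
    have "\<beta> * p < - 1" using \<beta> p by (simp add: field_simps)
    with quotient_tendsto[OF p] have "\<forall>\<^sub>F s in at_right 0. ?G s > \<beta> * p" by (rule order_tendstoD)
    then have "\<forall>\<^sub>F s in at_right 0. ?G s > \<beta> * p \<and> s \<in> {0<..<b}"
      using eventually_at_right_real[OF b(1)] by (rule eventually_conj)
    then obtain s where s: "?G s > \<beta> * p" "0 < s" "s < b"
      using eventually_happens'[OF trivial_limit_at_right_real] by fastforce
    then have "\<not> cos_p p (arcsin_p p s) < exp (\<beta> * arcsin_p p s powr p)"
      unfolding compare[OF s(2,3)] by simp
    then show ?thesis using in_range[OF s(2,3)] by blast
  qed
  show ?thesis using bounds alpha beta by blast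
qed

end
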